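(* For every integer $p\geq 0$ and every integer $t\geq 0$, there is a graph $G$ of treewidth at most $t$ with \[\chi_p(G)\geq \binom{p+t}{t}.\]
   Context: All graphs are finite and simple. For an integer $p\geq 0$, a vertex coloring $\phi$ of a graph $G$ is $p$-centered if for every connected subgraph $H$ of $G$, either $\phi$ uses more than $p$ colors on $V(H)$ or there is a color that appears on exactly one vertex of $H$. The $p$-centered chromatic number $\chi_p(G)$ is the minimum number of colors in a $p$-centered coloring of $G$. Treewidth is the usual notion (minimum over tree-decompositions of the maximum bag size minus one). *)

theory Defs
  imports Complex_Main "Graph_Theory.Digraph_Component"
begin

text \<open>
  A finite simple graph is a \<^locale>\<open>pair_graph\<close>: a finite loopfree digraph with a symmetric arc
  relation, each undirected edge \<open>uv\<close> being represented by the arcs \<open>(u, v)\<close> and \<open>(v, u)\<close>.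
\<close>


section \<open>Centered colorings\<close>

text \<open>
  The library predicate \<^const>\<open>connected\<close> is false for the graph without vertices, so \<open>H\<close> below is
  nonempty.
\<close>

definition centered_coloring :: "nat \<Rightarrow> 'a pair_pre_digraph \<Rightarrow> ('a \<Rightarrow> 'c) \<Rightarrow> bool" where
  "centered_coloring p G \<phi> \<longleftrightarrow>
     (\<forall>H. pair_graph H \<longrightarrow> subgraph (with_proj H) (with_proj G) \<longrightarrow> connected (with_proj H) \<longrightarrow>
        p < card (\<phi> ` pverts H) \<or> (\<exists>c. \<exists>!v. v \<in> pverts H \<and> \<phi> v = c))"

definition centered_chromatic_number :: "nat \<Rightarrow> 'a pair_pre_digraph \<Rightarrow> nat" where
  "centered_chromatic_number p G =
     (LEAST k. \<exists>\<phi> :: 'a \<Rightarrow> nat. centered_coloring p G \<phi> \<and> card (\<phi> ` pverts G) = k)"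


section \<open>Treewidth\<close>

text \<open>
  The library predicate \<^const>\<open>tree\<close> does not describe undirected trees: in a symmetric digraph any
  edge traversed back and forth is a \<^const>\<open>pre_digraph.cycle\<close> of length 2. The cycles of the
  undirected graph are those of length at least 3.
\<close>

definition undirected_tree :: "'t pair_pre_digraph \<Rightarrow> bool" where
  "undirected_tree T \<longleftrightarrow> pair_graph T \<and> connected (with_proj T) \<and>
     \<not> (\<exists>c. pre_digraph.cycle (with_proj T) c \<and> 3 \<le> length c)"

definition tree_decomposition ::
    "'a pair_pre_digraph \<Rightarrow> 't pair_pre_digraph \<Rightarrow> ('t \<Rightarrow> 'a set) \<Rightarrow> bool" where
  "tree_decomposition G T B \<longleftrightarrow>
     undirected_tree T \<and>
     (\<Union>x \<in> pverts T. B x) = pverts G \<and>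
     (\<forall>(u, v) \<in> parcs G. \<exists>x \<in> pverts T. u \<in> B x \<and> v \<in> B x) \<and>
     (\<forall>v \<in> pverts G. connected (with_proj T \<restriction> {x \<in> pverts T. v \<in> B x}))"

text \<open>Widths are integers, since the graph without vertices has treewidth \<open>-1\<close>.\<close>

definition decomposition_width :: "'t pair_pre_digraph \<Rightarrow> ('t \<Rightarrow> 'a set) \<Rightarrow> int" where
  "decomposition_width T B = int (Max ((\<lambda>x. card (B x)) ` pverts T)) - 1"

text \<open>
  Decomposition trees are finite, so up to isomorphism their nodes are natural numbers; likewise for
  the colors in \<^const>\<open>centered_chromatic_number\<close>.
\<close>

definition treewidth :: "'a pair_pre_digraph \<Rightarrow> int" where
  "treewidth G =
     (LEAST w. \<exists>(T :: nat pair_pre_digraph) B. tree_decomposition G T B \<and> w = decomposition_width T B)"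


section \<open>The minima are attained\<close>

lemma centered_coloring_inj:
  assumes "inj_on \<phi> (pverts G)"
  shows "centered_coloring p G \<phi>"
  unfolding centered_coloring_def
proof (intro allI impI disjI2)
  fix H assume "subgraph (with_proj H) (with_proj G)" "connected (with_proj H)"
  then have sub: "pverts H \<subseteq> pverts G" and "pverts H \<noteq> {}"
    by (auto simp: subgraph_def connected_def strongly_connected_def mk_symmetric_def)
  then obtain v where "v \<in> pverts H" by blast
  with sub assms show "\<exists>c. \<exists>!v. v \<in> pverts H \<and> \<phi> v = c"
    by (intro exI[of _ "\<phi> v"] ex1I[of _ v]) (auto dest: inj_onD)
qed

lemma centered_chromatic_number_attained:
  fixes G :: "'a pair_pre_digraph"
  assumes "pair_graph G"
  obtains \<phi> :: "'a \<Rightarrow> nat"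
  where "centered_coloring p G \<phi>" "card (\<phi> ` pverts G) = centered_chromatic_number p G"
proof -
  have "finite (pverts G)"
    using assms by (simp add: pair_graph_def pair_digraph_def pair_fin_digraph.pair_finite_verts)
  then obtain \<psi> :: "'a \<Rightarrow> nat" where "inj_on \<psi> (pverts G)"
    using finite_imp_inj_to_nat_seg by metis
  then have "\<exists>k. \<exists>\<phi> :: 'a \<Rightarrow> nat. centered_coloring p G \<phi> \<and> card (\<phi> ` pverts G) = k"
    using centered_coloring_inj by blast
  from LeastI_ex[OF this] show ?thesis
    using that unfolding centered_chromatic_number_def by blast
qed

lemma tree_decomposition_trivial:
  fixes G :: "'a pair_pre_digraph"
  assumes "pair_graph G"
  shows "tree_decomposition G \<lparr>pverts = {0 :: nat}, parcs = {}\<rparr> (\<lambda>_. pverts G)"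
proof -
  let ?T = "\<lparr>pverts = {0 :: nat}, parcs = {}\<rparr>"
  interpret G: pair_graph G by fact
  have T: "pair_graph ?T"
    by unfold_locales (auto simp: symmetric_def)
  have conn: "connected (with_proj ?T)"
    by (auto simp: connected_def strongly_connected_def mk_symmetric_def reachable_def)
  have "with_proj ?T \<restriction> {0} = with_proj ?T"
    by (simp add: induce_subgraph_def with_proj_def)
  with conn have conn0: "connected (with_proj ?T \<restriction> {0})"
    by (simp only:)
  have "\<not> pre_digraph.cycle (with_proj ?T) c" for c
    by (auto simp: pre_digraph.cycle_def pre_digraph.awalk_def)
  then show ?thesis
    using T conn conn0 by (auto simp: tree_decomposition_def undirected_tree_def dest: G.wellformed')
qed

lemma treewidth_attained:
  fixes G :: "'a pair_pre_digraph"
  assumes "pair_graph G"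
  obtains T :: "nat pair_pre_digraph" and B
  where "tree_decomposition G T B" "treewidth G = decomposition_width T B"
    and "\<And>(T' :: nat pair_pre_digraph) B'.
      tree_decomposition G T' B' \<Longrightarrow> treewidth G \<le> decomposition_width T' B'"
proof -
  define P where "P = (\<lambda>w. \<exists>(T :: nat pair_pre_digraph) B.
    tree_decomposition G T B \<and> w = decomposition_width T B)"
  have "\<exists>w. P w"
    using tree_decomposition_trivial[OF assms] unfolding P_def by blast
  then obtain w where w: "P w" and min: "\<And>w'. P w' \<Longrightarrow> nat (w + 1) \<le> nat (w' + 1)"
    using ex_has_least_nat[of P _ "\<lambda>w. nat (w + 1)"] by metis
  have lb: "-1 \<le> w'" if "P w'" for w'
    using that by (auto simp: P_def decomposition_width_def)
  have le: "w \<le> w'" if "P w'" for w'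
    using min[OF that] lb[OF that] lb[OF w] by linarith
  have "treewidth G = w"
    unfolding treewidth_def P_def[symmetric] using w le by (rule Least_equality)
  then show ?thesis
    using w le that unfolding P_def by blast
qed

end

theory Submission
  imports Defs
begin

text \<open>
  The graph \<open>G(p, t)\<close> is a single vertex if \<open>p = 0\<close> or \<open>t = 0\<close>; otherwise it arises from \<open>G(p - 1, t)\<close> by
  attaching to every vertex \<open>v\<close> many disjoint copies of \<open>G(p, t - 1)\<close>, all of whose vertices become
  adjacent to \<open>v\<close>. If the number of colors is less than the number of copies, then by induction
  every \<open>p\<close>-centered coloring has a vertex \<open>v\<close> and \<open>(p + t) choose t\<close> colors \<open>c\<close>, each with a connected
  vertex set containing \<open>v\<close> and \<open>c\<close>, with at most \<open>p + 1\<close> colors, in which every color except possibly \<open>c\<close>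
  occurs at least twice. The two summands of Pascal's rule are the colors found at \<open>v\<close> in
  \<open>G(p - 1, t)\<close> and those found inside one copy of \<open>G(p, t - 1)\<close> attached to \<open>v\<close>.
\<close>


section \<open>Connectedness\<close>

text \<open>Walks into \<open>r\<close> can be reversed by symmetry, so any two vertices are joined
  through \<open>r\<close>.\<close>

lemma connected_rootI:
  assumes "wf_digraph G" "symmetric G" "r \<in> verts G"
    and "\<And>u. u \<in> verts G \<Longrightarrow> u \<rightarrow>\<^sup>*\<^bsub>G\<^esub> r"
  shows "connected G"
proof -
  interpret wf_digraph G by fact
  have "u \<rightarrow>\<^sup>*\<^bsub>G\<^esub> v" if "u \<in> verts G" "v \<in> verts G" for u v
    using assms(4)[OF that(1)] symmetric_reachable[OF assms(2) assms(4)[OF that(2)]]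
    by (rule reachable_trans)
  then show ?thesis
    using assms(2,3) unfolding connected_def strongly_connected_def
    by (auto simp: reachable_mk_symmetric_eq)
qed

text \<open>Stands in for connected vertex sets: growing a set along arcs is stable under adding a
  neighbour and under arc-preserving maps, the two operations of the lower bound. The new vertex may
  already lie in the set, so even maps that are not injective preserve it.\<close>

inductive arc_grown :: "('a \<times> 'a) set \<Rightarrow> 'a set \<Rightarrow> bool" for E where
  single: "arc_grown E {v}"
| step: "arc_grown E K \<Longrightarrow> u \<in> K \<Longrightarrow> (u, w) \<in> E \<Longrightarrow> arc_grown E (insert w K)"

lemma arc_grown_image:
  assumes "arc_grown E K" "\<And>x y. (x, y) \<in> E \<Longrightarrow> (f x, f y) \<in> E'"
  shows "arc_grown E' (f ` K)"
  using assms(1)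
proof induction
  case (step K u w)
  then show ?case
    using arc_grown.step[of E' "f ` K" "f u" "f w"] assms(2) by auto
qed (simp add: arc_grown.single)

lemma arc_grown_mono: "arc_grown E K \<Longrightarrow> E \<subseteq> E' \<Longrightarrow> arc_grown E' K"
  using arc_grown_image[of E K id E'] by auto

text \<open>The starting vertex is the root. By symmetry each added vertex has an arc back to the
  vertex it was grown from, and that arc lies inside the enlarged set.\<close>

lemma arc_grown_imp_root:
  assumes "arc_grown E K" "sym E"
  shows "\<exists>r\<in>K. \<forall>x\<in>K. (x, r) \<in> (E \<inter> K \<times> K)\<^sup>*"
  using assms(1)
proof induction
  case (step K u w)
  then obtain r where r: "r \<in> K" "\<And>x. x \<in> K \<Longrightarrow> (x, r) \<in> (E \<inter> K \<times> K)\<^sup>*"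
    by blast
  let ?E = "E \<inter> insert w K \<times> insert w K"
  have "(E \<inter> K \<times> K)\<^sup>* \<subseteq> ?E\<^sup>*"
    by (rule rtrancl_mono) auto
  with r have *: "(x, r) \<in> ?E\<^sup>*" if "x \<in> K" for x
    using that by blast
  moreover have "(w, u) \<in> ?E"
    using step assms(2) by (auto dest: symD)
  with *[OF step.hyps(2)] have "(w, r) \<in> ?E\<^sup>*"
    by (rule converse_rtrancl_into_rtrancl[rotated])
  ultimately show ?case
    using r(1) by auto
qed simp

lemma arc_grown_connected:
  assumes "arc_grown E K" "sym E"
  shows "connected (with_proj \<lparr>pverts = K, parcs = E \<inter> K \<times> K\<rparr>)"
proof -
  let ?H = "with_proj \<lparr>pverts = K, parcs = E \<inter> K \<times> K\<rparr>"
  obtain r where r: "r \<in> K" "\<And>x. x \<in> K \<Longrightarrow> (x, r) \<in> (E \<inter> K \<times> K)\<^sup>*"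
    using arc_grown_imp_root[OF assms] by blast
  have wf: "wf_digraph ?H"
    by unfold_locales auto
  have "x \<rightarrow>\<^sup>*\<^bsub>?H\<^esub> r" if "x \<in> K" for x
    using r(2)[OF that] that
  proof (induction rule: converse_rtrancl_induct)
    case base
    then show ?case
      using r(1) by (intro wf_digraph.reachable_refl[OF wf]) simp
  next
    case (step y z)
    then show ?case
      by (intro wf_digraph.adj_reachable_trans[OF wf, of y z]) auto
  qed
  then show ?thesis
    using assms(2) r(1) by (intro connected_rootI[OF wf]) (auto simp: symmetric_def sym_def)
qed


section \<open>Width certificates\<close>

text \<open>
  The decomposition tree has the vertices as nodes; \<open>\<pi>\<close> gives the parents, and the bag \<open>B v\<close> consists of
  \<open>v\<close> and of vertices from the bag of the parent.
\<close>

definition width_certificate ::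
    "nat \<Rightarrow> nat \<Rightarrow> (nat \<times> nat) set \<Rightarrow> (nat \<Rightarrow> nat) \<Rightarrow> (nat \<Rightarrow> nat set) \<Rightarrow> bool" where
  "width_certificate t n E \<pi> B \<longleftrightarrow>
     (\<forall>v. 0 < v \<longrightarrow> v < n \<longrightarrow> \<pi> v < v \<and> B v - {v} \<subseteq> B (\<pi> v)) \<and>
     (\<forall>v < n. v \<in> B v \<and> B v \<subseteq> {..v} \<and> card (B v) \<le> t + 1) \<and>
     (\<forall>u v. (u, v) \<in> E \<longrightarrow> u < v \<longrightarrow> u \<in> B v)"

lemma width_certificateD:
  assumes "width_certificate t n E \<pi> B"
  shows "0 < v \<Longrightarrow> v < n \<Longrightarrow> \<pi> v < v" "0 < v \<Longrightarrow> v < n \<Longrightarrow> B v - {v} \<subseteq> B (\<pi> v)"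
    "v < n \<Longrightarrow> v \<in> B v" "v < n \<Longrightarrow> B v \<subseteq> {..v}" "v < n \<Longrightarrow> card (B v) \<le> t + 1"
    "(u, v) \<in> E \<Longrightarrow> u < v \<Longrightarrow> u \<in> B v"
  using assms unfolding width_certificate_def by simp_all

text \<open>The invariant of the construction. Positivity of \<open>n\<close> supplies the root
  \<open>0\<close> of the decomposition tree.\<close>

definition has_width :: "nat \<Rightarrow> nat \<Rightarrow> (nat \<times> nat) set \<Rightarrow> bool" where
  "has_width t n E \<longleftrightarrow> 0 < n \<and> sym E \<and> (\<forall>(u, v) \<in> E. u < n \<and> v < n \<and> u \<noteq> v) \<and>
     (\<exists>\<pi> B. width_certificate t n E \<pi> B)"

lemma has_width_single: "has_width t 1 {}"
proof -
  have "width_certificate t 1 {} id (\<lambda>v. {v})"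
    by (auto simp: width_certificate_def)
  then show ?thesis
    unfolding has_width_def by (auto simp: sym_def)
qed

section \<open>Trees given by a parent function\<close>

definition parent_tree :: "(nat \<Rightarrow> nat) \<Rightarrow> nat \<Rightarrow> nat pair_pre_digraph" where
  "parent_tree \<pi> n = \<lparr>pverts = {..<n},
     parcs = (\<lambda>v. (v, \<pi> v)) ` {0<..<n} \<union> (\<lambda>v. (\<pi> v, v)) ` {0<..<n}\<rparr>"

context
  fixes \<pi> :: "nat \<Rightarrow> nat" and n :: nat
  assumes parent_less: "\<And>v. 0 < v \<Longrightarrow> v < n \<Longrightarrow> \<pi> v < v"
begin

lemma parent_tree_arcs:
  "(u, v) \<in> parcs (parent_tree \<pi> n) \<longleftrightarrow>
     u < n \<and> v < n \<and> (0 < u \<and> v = \<pi> u \<or> 0 < v \<and> u = \<pi> v)"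
proof -
  have "\<pi> x < n" if "0 < x" "x < n" for x
    using parent_less[OF that] that by simp
  then show ?thesis
    by (auto simp: parent_tree_def image_iff)
qed

lemma pair_graph_parent_tree: "pair_graph (parent_tree \<pi> n)"
proof
  show "finite (pverts (parent_tree \<pi> n))" "finite (parcs (parent_tree \<pi> n))"
    by (auto simp: parent_tree_def)
  show "symmetric (with_proj (parent_tree \<pi> n))"
    unfolding symmetric_def with_proj_simps sym_def parent_tree_arcs by blast
next
  fix e assume "e \<in> parcs (parent_tree \<pi> n)"
  then have e: "(fst e, snd e) \<in> parcs (parent_tree \<pi> n)"
    by simp
  then show "fst e \<in> pverts (parent_tree \<pi> n)" "snd e \<in> pverts (parent_tree \<pi> n)"
    unfolding parent_tree_arcs by (simp_all add: parent_tree_def)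
  show "fst e \<noteq> snd e"
    using e parent_less unfolding parent_tree_arcs by (metis less_irrefl)
qed

text \<open>Passing to the parent decreases the vertex and stays inside \<open>S\<close>, so it must
  end at the minimum \<open>r\<close>. This serves both for the whole tree and for the nodes whose
  bags contain a given vertex.\<close>

lemma connected_parent_tree_induced:
  assumes "r \<in> S" "r < n" "\<And>x. x \<in> S \<Longrightarrow> x < n \<and> r \<le> x"
    and "\<And>x. x \<in> S \<Longrightarrow> x \<noteq> r \<Longrightarrow> \<pi> x \<in> S"
  shows "connected (with_proj (parent_tree \<pi> n) \<restriction> S)"
proof -
  let ?T = "with_proj (parent_tree \<pi> n)"
  let ?H = "?T \<restriction> S"
  interpret T: pair_graph "parent_tree \<pi> n"
    by (rule pair_graph_parent_tree)
  have wf: "wf_digraph ?H"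
    by unfold_locales auto
  have ends: "(u, v) \<in> arcs_ends ?H \<longleftrightarrow> u \<in> S \<and> v \<in> S \<and> (u, v) \<in> parcs (parent_tree \<pi> n)" for u v
    by (auto simp: arcs_ends_conv image_iff) 
  have "x \<rightarrow>\<^sup>*\<^bsub>?H\<^esub> r" if "x \<in> S" for x
    using that
  proof (induction x rule: less_induct)
    case (less x)
    show ?case
    proof (cases "x = r")
      case True
      then show ?thesis
        using assms(1) by (auto intro: wf_digraph.reachable_refl[OF wf])
    next
      case False
      with assms(3)[OF less.prems] have x: "0 < x" "x < n"
        by auto
      have "\<pi> x \<in> S"
        using assms(4) less.prems False by blast
      moreover have "(x, \<pi> x) \<in> arcs_ends ?H"
        using calculation x less.prems parent_less[OF x] by (auto simp: ends parent_tree_arcs)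
      ultimately show ?thesis
        using less.IH[OF parent_less[OF x]] wf_digraph.adj_reachable_trans[OF wf] by blast
    qed
  qed
  moreover have "symmetric ?H"
    unfolding symmetric_def sym_def ends parent_tree_arcs by blast
  ultimately show ?thesis
    using assms(1) by (intro connected_rootI[OF wf]) auto
qed

end

lemma pcas_nth:
  assumes "pcas u c v" "i < length c"
  shows "snd (c ! i) = (if Suc i < length c then fst (c ! Suc i) else v)"
  using assms
proof (induction c arbitrary: u i)
  case (Cons e c)
  then show ?case
    by (cases c; cases i) auto
qed simp

lemma pcas_hd: "c \<noteq> [] \<Longrightarrow> pcas u c v \<Longrightarrow> fst (c ! 0) = u"
  by (cases c) auto

text \<open>At the largest vertex of a cycle, both neighbours on the cycle are its parent.\<close>

lemma parent_tree_no_cycle: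
  assumes "\<And>v. 0 < v \<Longrightarrow> v < n \<Longrightarrow> \<pi> v < v"
    and "pre_digraph.cycle (with_proj (parent_tree \<pi> n)) c"
  shows "length c < 3"
proof (rule ccontr)
  assume "\<not> length c < 3"
  define L where "L = length c"
  have L: "3 \<le> L"
    using \<open>\<not> length c < 3\<close> by (simp add: L_def)
  interpret T: pair_graph "parent_tree \<pi> n"
    using assms(1) by (rule pair_graph_parent_tree)
  obtain u where walk: "set c \<subseteq> parcs (parent_tree \<pi> n)" "pcas u c u"
    and dist: "distinct (tl (pawalk_verts u c))"
    using assms(2) by (auto simp: T.cycle_def T.awalk_def)
  have "c \<noteq> []"
    using L L_def by auto
  with walk(2) dist have dist: "distinct (map snd c)"
    using T.awalk_verts_conv'[of u c u] by simp
  \<comment> \<open>Heads of arcs are used because the distinctness demanded of a cycle excludes its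
    first vertex; what remains is the list of heads.\<close>
  define w where "w i = snd (c ! i)" for i
  have fst_next: "fst (c ! (Suc i mod L)) = w i" if "i < L" for i
    using pcas_nth[OF walk(2), of i] pcas_hd[OF \<open>c \<noteq> []\<close> walk(2)] that
    by (cases "Suc i = L") (auto simp: w_def L_def)
  have arc: "(w i, w (Suc i mod L)) \<in> parcs (parent_tree \<pi> n)" if "i < L" for i
  proof -
    have "c ! (Suc i mod L) \<in> set c"
      using \<open>c \<noteq> []\<close> unfolding L_def by (intro nth_mem mod_less_divisor) simp
    moreover have "c ! (Suc i mod L) = (w i, w (Suc i mod L))"
      using fst_next[OF that] by (simp add: w_def prod_eq_iff)
    ultimately show ?thesis
      using walk(1) by auto
  qed
  have inj: "w i \<noteq> w j" if "i < L" "j < L" "i \<noteq> j" for i j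
    using dist that by (auto simp: distinct_conv_nth w_def L_def)
  have fin: "finite (w ` {..<L})" and ne: "w ` {..<L} \<noteq> {}"
    using L by (auto simp: lessThan_empty_iff)
  obtain i where i: "i < L" "w i = Max (w ` {..<L})"
    using Max_in[OF fin ne] by auto
  have max: "w j \<le> w i" if "j < L" for j
    using Max_ge[OF fin] that i(2) by auto
  define k where "k = (if i = 0 then L - 1 else i - 1)"
  define j where "j = Suc i mod L"
  have k: "k < L" "Suc k mod L = i" and j: "j < L"
    using i L by (auto simp: k_def j_def)
  \<comment> \<open>Here \<open>3 \<le> L\<close> matters: on a closed walk of length 2 the
    predecessor and the successor coincide.\<close>
  have "k \<noteq> j"
    using i L by (cases "Suc i = L") (auto simp: k_def j_def split: if_splits)
  have parent: "w l = \<pi> (w i)" if "l < L" "(w l, w i) \<in> parcs (parent_tree \<pi> n)" for l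
  proof -
    have "w l < n" "0 < w l \<and> w i = \<pi> (w l) \<or> w l = \<pi> (w i)"
      using that(2) parent_tree_arcs[of n \<pi> "w l" "w i", OF assms(1)] by simp_all blast
    then show ?thesis
      using max[OF that(1)] assms(1)[of "w l"] by auto
  qed
  have "w k = \<pi> (w i)"
    using arc[OF k(1)] unfolding k(2) by (rule parent[OF k(1)])
  moreover have "w j = \<pi> (w i)"
    using T.arcs_symmetric[OF arc[OF i(1)]] unfolding j_def[symmetric] by (rule parent[OF j])
  ultimately show False
    using inj[OF k(1) j \<open>k \<noteq> j\<close>] by simp
qed

lemma undirected_tree_parent_tree:
  assumes "\<And>v. 0 < v \<Longrightarrow> v < n \<Longrightarrow> \<pi> v < v" "0 < n"
  shows "undirected_tree (parent_tree \<pi> n)"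
proof -
  let ?T = "with_proj (parent_tree \<pi> n)"
  interpret T: pair_graph "parent_tree \<pi> n"
    using assms(1) by (rule pair_graph_parent_tree)
  have verts: "pverts (parent_tree \<pi> n) = {..<n}"
    by (simp add: parent_tree_def)
  have "connected (?T \<restriction> {..<n})"
    using assms by (intro connected_parent_tree_induced[of n \<pi> 0]) (auto intro: less_trans)
  moreover have "?T \<restriction> {..<n} = ?T"
    using T.wellformed' by (force simp: induce_subgraph_def with_proj_def verts)
  ultimately have "connected ?T"
    by (simp only:)
  then show ?thesis
    using parent_tree_no_cycle[OF assms(1)] T.pair_graph
    by (force simp: undirected_tree_def)
qed

lemma has_width_treewidth:
  assumes "has_width t n E"
  defines "G \<equiv> \<lparr>pverts = {..<n}, parcs = E\<rparr>"
  shows "pair_graph G" "treewidth G \<le> int t"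
proof -
  have n: "0 < n" "sym E" and E: "\<And>u v. (u, v) \<in> E \<Longrightarrow> u < n \<and> v < n \<and> u \<noteq> v"
    using assms(1) by (auto simp: has_width_def)
  obtain \<pi> B where "width_certificate t n E \<pi> B"
    using assms(1) unfolding has_width_def by blast
  note \<pi> = width_certificateD(1,2)[OF this] and B = width_certificateD(3-5)[OF this]
    and EB = width_certificateD(6)[OF this]
  have "finite E"
    using E by (intro finite_subset[of E "{..<n} \<times> {..<n}"]) auto
  with n E show G: "pair_graph G"
    by unfold_locales (auto simp: G_def symmetric_def)
  let ?T = "parent_tree \<pi> n"
  have verts: "pverts ?T = {..<n}"
    by (simp add: parent_tree_def)
  have "tree_decomposition G ?T B"
    unfolding tree_decomposition_def
  proof (intro conjI ballI)
    show "undirected_tree ?T"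
      using \<pi>(1) n(1) by (rule undirected_tree_parent_tree)
    show "(\<Union>x\<in>pverts ?T. B x) = pverts G"
    proof
      have "B x \<subseteq> {..<n}" if "x < n" for x
        using B(2)[OF that] that by (auto dest: subsetD)
      then show "(\<Union>x\<in>pverts ?T. B x) \<subseteq> pverts G"
        by (auto simp: verts G_def)
      show "pverts G \<subseteq> (\<Union>x\<in>pverts ?T. B x)"
        using B(1) by (auto simp: verts G_def)
    qed
  next
    fix e assume "e \<in> parcs G"
    then obtain u v where e: "e = (u, v)" "(u, v) \<in> E" "(v, u) \<in> E"
      using n(2) by (cases e) (auto simp: G_def dest: symD)
    \<comment> \<open>The node of the larger endpoint works, since its bag contains the smaller
      one.\<close>
    have "\<exists>x<n. u \<in> B x \<and> v \<in> B x"
      using EB[OF e(2)] EB[OF e(3)] E[OF e(2)] B(1) by (metis nat_neq_iff)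
    then show "case e of (u, v) \<Rightarrow> \<exists>x\<in>pverts ?T. u \<in> B x \<and> v \<in> B x"
      by (auto simp: e verts)
  next
    fix v assume "v \<in> pverts G"
    then have v: "v < n"
      by (simp add: G_def)
    \<comment> \<open>A node other than \<open>v\<close> whose bag contains \<open>v\<close> passes
      \<open>v\<close> on to its parent. Among these nodes \<open>v\<close> is the least, because
      the bag of \<open>x\<close> has no vertex above \<open>x\<close>.\<close>
    have "\<pi> x \<in> {x \<in> {..<n}. v \<in> B x}" if x: "x < n" "v \<in> B x" "x \<noteq> v" for x
    proof -
      have "0 < x"
        using B(2)[OF x(1)] x by auto
      then show ?thesis
        using \<pi>[of x] x by auto
    qed
    then show "connected (with_proj ?T \<restriction> {x \<in> pverts ?T. v \<in> B x})"
      using \<pi>(1) B(1)[OF v] B(2) v unfolding verts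
      by (intro connected_parent_tree_induced[of n \<pi> v]) (auto dest: subsetD)
  qed
  then have "treewidth G \<le> decomposition_width ?T B"
    using treewidth_attained[OF G] by metis
  also have "Max ((\<lambda>x. card (B x)) ` pverts ?T) \<le> t + 1"
    using B(3) n(1) by (intro Max.boundedI) (auto simp: verts)
  then have "decomposition_width ?T B \<le> int t"
    by (simp add: decomposition_width_def)
  finally show "treewidth G \<le> int t" .
qed


section \<open>Attaching cones\<close>

text \<open>New vertices are numbered from \<open>n\<close> on, so that old ones keep their numbers
  and an apex \<open>v < n\<close> precedes its cone, as parents must in a certificate.\<close>

definition attach_cone ::
    "nat \<Rightarrow> (nat \<times> nat) set \<Rightarrow> nat \<Rightarrow> nat \<Rightarrow> (nat \<times> nat) set \<Rightarrow> (nat \<times> nat) set" where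
  "attach_cone n E v m A = E \<union> (\<lambda>(x, y). (n + x, n + y)) ` A \<union>
     (\<lambda>x. (v, n + x)) ` {..<m} \<union> (\<lambda>x. (n + x, v)) ` {..<m}"

text \<open>Each bag of the cone is a shifted bag for \<open>A\<close> with the apex
  \<open>v\<close> added, which raises the width bound from \<open>t\<close> to
  \<open>Suc t\<close>. Old bags are unchanged, and the root of the cone is hung below node
  \<open>v\<close>.\<close>

lemma has_width_attach_cone:
  assumes "has_width (Suc t) n E" "has_width t m A" "v < n"
  shows "has_width (Suc t) (n + m) (attach_cone n E v m A)"
proof -
  have n: "0 < n" "sym E" and E: "\<And>x y. (x, y) \<in> E \<Longrightarrow> x < n \<and> y < n \<and> x \<noteq> y"
    using assms(1) by (auto simp: has_width_def)
  have m: "0 < m" "sym A" and A: "\<And>x y. (x, y) \<in> A \<Longrightarrow> x < m \<and> y < m \<and> x \<noteq> y"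
    using assms(2) by (auto simp: has_width_def)
  obtain \<pi> B where "width_certificate (Suc t) n E \<pi> B"
    using assms(1) unfolding has_width_def by blast
  note E_cert = width_certificateD[OF this]
  obtain \<rho> C where "width_certificate t m A \<rho> C"
    using assms(2) unfolding has_width_def by blast
  note A_cert = width_certificateD[OF this]
  let ?E = "attach_cone n E v m A"
  define \<sigma> where "\<sigma> x = (if x < n then \<pi> x else if x = n then v else n + \<rho> (x - n))" for x
  define D where "D x = (if x < n then B x else insert v ((+) n ` C (x - n)))" for x
  have "\<sigma> x < x \<and> D x - {x} \<subseteq> D (\<sigma> x)" if x: "0 < x" "x < n + m" for x
  proof -
    consider "x < n" | "x = n" | "n < x"
      by linarith
    then show ?thesis
    proof cases
      case 1
      then show ?thesis
        using E_cert(1,2)[of x] x by (auto simp: \<sigma>_def D_def)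
    next
      \<comment> \<open>At the root of the cone, \<open>C 0\<close> contains at most
        \<open>0\<close>, so the bag without \<open>n\<close> itself is just \<open>{v}\<close>, and
        \<open>v\<close> lies in its own bag.\<close>
      case 2
      then show ?thesis
        using A_cert(4)[of 0] m(1) E_cert(3)[OF assms(3)] assms(3) by (auto simp: \<sigma>_def D_def)
    next
      case 3
      then obtain y where y: "x = n + y" "0 < y"
        using less_imp_add_positive by blast
      with x have "\<rho> y < y" "C y - {y} \<subseteq> C (\<rho> y)"
        using A_cert(1,2)[of y] by simp_all
      then show ?thesis
        using y by (auto simp: \<sigma>_def D_def)
    qed
  qed
  moreover have "x \<in> D x \<and> D x \<subseteq> {..x} \<and> card (D x) \<le> Suc t + 1" if "x < n + m" for x
  proof (cases "x < n")
    case True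
    then show ?thesis
      using E_cert(3-5)[of x] by (simp add: D_def)
  next
    case False
    define y where "y = x - n"
    have y: "x = n + y" "y < m"
      using False that by (auto simp: y_def)
    have "card (insert v ((+) n ` C y)) \<le> Suc (card ((+) n ` C y))"
      by (simp add: card_insert_le_m1)
    also have "card ((+) n ` C y) = card (C y)"
      by (rule card_image) simp
    finally show ?thesis
      using A_cert(3-5)[OF y(2)] y assms(3) by (auto simp: D_def)
  qed
  moreover have "x \<in> D y" if xy: "(x, y) \<in> ?E" "x < y" for x y
  proof -
    consider "(x, y) \<in> E" | a b where "(a, b) \<in> A" "x = n + a" "y = n + b" | "x = v" "n \<le> y"
      using xy assms(3) by (auto simp: attach_cone_def)
    then show ?thesis
    proof cases
      case 1
      then show ?thesis
        using E_cert(6) E xy(2) by (auto simp: D_def)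
    next
      case 2
      then show ?thesis
        using A_cert(6)[of a b] xy(2) by (auto simp: D_def)
    qed (simp add: D_def)
  qed
  ultimately have "width_certificate (Suc t) (n + m) ?E \<sigma> D"
    unfolding width_certificate_def by blast
  moreover have "sym ?E"
    using n(2) m(2) by (auto simp: attach_cone_def sym_def)
  moreover have "x < n + m \<and> y < n + m \<and> x \<noteq> y" if "(x, y) \<in> ?E" for x y
    using that E A assms(3) by (fastforce simp: attach_cone_def)
  ultimately show ?thesis
    using n(1) unfolding has_width_def by blast
qed

text \<open>Cone number \<open>l\<close> occupies the block of \<open>m\<close> numbers from
  \<open>n + l * m\<close>, and its apex is an old vertex. Only the presence of arcs is recorded,
  because the lower bound never needs an arc to be absent.\<close>

lemma has_width_attach_cones:
  assumes "has_width (Suc t) n E" "has_width t m A" "\<And>l. l < L \<Longrightarrow> f l < n"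
  shows "\<exists>E'. has_width (Suc t) (n + L * m) E' \<and> E \<subseteq> E' \<and>
    (\<forall>l<L. (\<forall>x<m. (f l, n + l * m + x) \<in> E') \<and>
      (\<forall>(x, y)\<in>A. (n + l * m + x, n + l * m + y) \<in> E'))"
  using assms(3)
proof (induction L)
  case 0
  then show ?case
    using assms(1) by auto
next
  case (Suc L)
  then obtain E' where E': "has_width (Suc t) (n + L * m) E'" "E \<subseteq> E'"
    "\<forall>l<L. (\<forall>x<m. (f l, n + l * m + x) \<in> E') \<and>
      (\<forall>(x, y)\<in>A. (n + l * m + x, n + l * m + y) \<in> E')"
    by fastforce
  let ?E = "attach_cone (n + L * m) E' (f L) m A"
  have "has_width (Suc t) (n + L * m + m) ?E"
    using E'(1) assms(2) Suc.prems[of L] by (intro has_width_attach_cone) auto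
  moreover have "E' \<subseteq> ?E" "\<forall>x<m. (f L, n + L * m + x) \<in> ?E"
    "\<forall>(x, y)\<in>A. (n + L * m + x, n + L * m + y) \<in> ?E"
    by (force simp: attach_cone_def)+
  moreover have "(\<forall>x<m. (f l, n + l * m + x) \<in> ?E) \<and>
      (\<forall>(x, y)\<in>A. (n + l * m + x, n + l * m + y) \<in> ?E)" if "l < L" for l
    using E'(3) that \<open>E' \<subseteq> ?E\<close> by blast
  ultimately have "has_width (Suc t) (n + Suc L * m) ?E \<and> E \<subseteq> ?E \<and>
    (\<forall>l<Suc L. (\<forall>x<m. (f l, n + l * m + x) \<in> ?E) \<and>
      (\<forall>(x, y)\<in>A. (n + l * m + x, n + l * m + y) \<in> ?E))"
    using E'(2) by (simp add: less_Suc_eq add.assoc add.commute[of m] all_conj_distrib imp_conjR)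
  then show ?case
    by blast
qed


section \<open>Colors forced near a vertex\<close>

definition centered_on :: "nat \<Rightarrow> nat \<Rightarrow> (nat \<times> nat) set \<Rightarrow> (nat \<Rightarrow> 'c) \<Rightarrow> bool" where
  "centered_on p n E \<phi> \<longleftrightarrow> (\<forall>K. arc_grown E K \<and> K \<subseteq> {..<n} \<longrightarrow>
     p < card (\<phi> ` K) \<or> (\<exists>v\<in>K. \<forall>w\<in>K. \<phi> w = \<phi> v \<longrightarrow> w = v))"

text \<open>The bound is \<open>Suc p\<close> and not \<open>p\<close>: adding a second vertex of
  color \<open>c\<close> repeats every color without adding one, which contradicts centeredness for
  \<open>Suc p\<close>, the parameter of the next stage.\<close>

definition color_witness ::
    "nat \<Rightarrow> nat \<Rightarrow> (nat \<times> nat) set \<Rightarrow> (nat \<Rightarrow> 'c) \<Rightarrow> nat \<Rightarrow> 'c \<Rightarrow> nat set \<Rightarrow> bool" where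
  "color_witness p n E \<phi> v c K \<longleftrightarrow> arc_grown E K \<and> K \<subseteq> {..<n} \<and> v \<in> K \<and> c \<in> \<phi> ` K \<and>
     card (\<phi> ` K) \<le> Suc p \<and> (\<forall>x\<in>K. \<phi> x \<noteq> c \<longrightarrow> (\<exists>y\<in>K. y \<noteq> x \<and> \<phi> y = \<phi> x))"

lemma color_witnessD:
  assumes "color_witness p n E \<phi> v c K"
  shows "arc_grown E K" "K \<subseteq> {..<n}" "v \<in> K" "c \<in> \<phi> ` K" "card (\<phi> ` K) \<le> Suc p"
    and "x \<in> K \<Longrightarrow> \<phi> x \<noteq> c \<Longrightarrow> \<exists>y\<in>K. y \<noteq> x \<and> \<phi> y = \<phi> x"
  using assms unfolding color_witness_def by blast+

text \<open>\<open>N\<close> stays fixed through the induction and becomes the number of cones per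
  vertex. The type argument names the colors, which otherwise occur only under the
  quantifier.\<close>

definition forces_colors :: "'c itself \<Rightarrow> nat \<Rightarrow> nat \<Rightarrow> nat \<Rightarrow> nat \<Rightarrow> (nat \<times> nat) set \<Rightarrow> bool" where
  "forces_colors _ N p k n E \<longleftrightarrow>
     (\<forall>\<phi> :: nat \<Rightarrow> 'c. centered_on p n E \<phi> \<longrightarrow> card (\<phi> ` {..<n}) < N \<longrightarrow>
       (\<exists>v<n. \<exists>C. finite C \<and> k \<le> card C \<and> (\<forall>c\<in>C. \<exists>K. color_witness p n E \<phi> v c K)))"

lemma forces_colorsE:
  fixes \<phi> :: "nat \<Rightarrow> 'c"
  assumes "forces_colors TYPE('c) N p k n E" "centered_on p n E \<phi>" "card (\<phi> ` {..<n}) < N"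
  obtains v C where "v < n" "finite C" "k \<le> card C"
    "\<forall>c\<in>C. \<exists>K. color_witness p n E \<phi> v c K"
  using assms(1)[unfolded forces_colors_def, rule_format, OF assms(2,3)]
  by (elim exE conjE) (rule that)

lemma forces_colors_single: "forces_colors TYPE('c) N p 1 1 {}"
proof -
  have "color_witness p 1 {} \<phi> 0 (\<phi> 0) {0}" for \<phi> :: "nat \<Rightarrow> 'c"
    by (auto simp: color_witness_def arc_grown.single)
  then have "\<exists>v<1. \<exists>C. finite C \<and> 1 \<le> card C \<and> (\<forall>c\<in>C. \<exists>K. color_witness p 1 {} \<phi> v c K)"
    for \<phi> :: "nat \<Rightarrow> 'c"
    by (intro exI[of _ 0] conjI exI[of _ "{\<phi> 0}"]) auto
  then show ?thesis
    unfolding forces_colors_def by blast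
qed

text \<open>Connected sets map to connected sets with the same colors, and injectivity pulls a
  uniquely colored vertex back to one.\<close>

lemma centered_on_embed:
  assumes "centered_on q n' E' \<phi>" "p \<le> q" "inj g" "g ` {..<n} \<subseteq> {..<n'}"
    and "\<And>x y. (x, y) \<in> E \<Longrightarrow> (g x, g y) \<in> E'"
  shows "centered_on p n E (\<phi> \<circ> g)"
  unfolding centered_on_def
proof (intro allI impI)
  fix K assume K: "arc_grown E K \<and> K \<subseteq> {..<n}"
  then have "arc_grown E' (g ` K)" "g ` K \<subseteq> {..<n'}"
    using arc_grown_image[of E K g E'] assms(5) image_mono[of K "{..<n}" g] assms(4) by auto
  then have "q < card (\<phi> ` g ` K) \<or> (\<exists>v\<in>g ` K. \<forall>w\<in>g ` K. \<phi> w = \<phi> v \<longrightarrow> w = v)"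
    using assms(1) unfolding centered_on_def by blast
  then show "p < card ((\<phi> \<circ> g) ` K) \<or> (\<exists>v\<in>K. \<forall>w\<in>K. (\<phi> \<circ> g) w = (\<phi> \<circ> g) v \<longrightarrow> w = v)"
    using assms(2,3) by (auto simp: image_comp dest: injD)
qed

lemma color_witness_embed:
  assumes "color_witness p n E (\<phi> \<circ> g) v c K" "inj g" "g ` {..<n} \<subseteq> {..<n'}"
    and "\<And>x y. (x, y) \<in> E \<Longrightarrow> (g x, g y) \<in> E'"
  shows "color_witness p n' E' \<phi> (g v) c (g ` K)"
proof -
  note K = color_witnessD[OF assms(1)]
  have "arc_grown E' (g ` K)" "g ` K \<subseteq> {..<n'}"
    using arc_grown_image[of E K g E'] K(1) assms(4) image_mono[OF K(2), of g] assms(3) by auto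
  moreover have "\<exists>y\<in>g ` K. y \<noteq> x \<and> \<phi> y = \<phi> x" if x: "x \<in> g ` K" "\<phi> x \<noteq> c" for x
  proof -
    obtain x' where x': "x' \<in> K" "x = g x'"
      using x(1) by blast
    then obtain y where "y \<in> K" "y \<noteq> x'" "\<phi> (g y) = \<phi> x"
      using K(6)[of x'] x(2) by auto
    then show ?thesis
      using x'(2) assms(2) by (auto dest: injD)
  qed
  ultimately show ?thesis
    using K(3-5) unfolding color_witness_def by (simp add: image_comp)
qed

text \<open>
  The new vertex is a vertex of a cone attached to the old one, so that old witnesses extend to it;
  a cone contains no color with an old witness, since a vertex of that color would
  make the witness set violate centeredness.
\<close>

lemma forces_colors_cones:
  assumes base: "forces_colors TYPE('c) N p k n E"
    and cone: "forces_colors TYPE('c) N (Suc p) l m A"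
    and E': "E \<subseteq> E'" "n \<le> n'"
    and s_range: "\<And>v i. v < n \<Longrightarrow> i < N \<Longrightarrow> n \<le> s v i \<and> s v i + m \<le> n'"
    and s_disj: "\<And>v i j x y. i \<noteq> j \<Longrightarrow> x < m \<Longrightarrow> y < m \<Longrightarrow> i < N \<Longrightarrow> j < N \<Longrightarrow> s v i + x \<noteq> s v j + y"
    and s_join: "\<And>v i x. v < n \<Longrightarrow> i < N \<Longrightarrow> x < m \<Longrightarrow> (v, s v i + x) \<in> E'"
    and s_copy: "\<And>v i x y. v < n \<Longrightarrow> i < N \<Longrightarrow> (x, y) \<in> A \<Longrightarrow> (s v i + x, s v i + y) \<in> E'"
  shows "forces_colors TYPE('c) N (Suc p) (k + l) n' E'"
  unfolding forces_colors_def
proof (intro allI impI)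
  fix \<phi> :: "nat \<Rightarrow> 'c"
  assume cent: "centered_on (Suc p) n' E' \<phi>" and few: "card (\<phi> ` {..<n'}) < N"
  have few': "card (\<phi> ` S) < N" if "S \<subseteq> {..<n'}" for S
    using card_mono[OF _ image_mono[OF that, of \<phi>]] few by simp
  have "centered_on p n E \<phi>"
    using centered_on_embed[OF cent, of p id n E] E' by auto
  moreover have "card (\<phi> ` {..<n}) < N"
    using E'(2) by (intro few') auto
  ultimately obtain v C where v: "v < n" and C: "finite C" "k \<le> card C"
    and CK: "\<forall>c\<in>C. \<exists>K. color_witness p n E \<phi> v c K"
    by (rule forces_colorsE[OF base])
  have "\<exists>u D. u < m \<and> finite D \<and> l \<le> card D \<and>
      (\<forall>c\<in>D. \<exists>K. color_witness (Suc p) m A (\<phi> \<circ> (+) (s v i)) u c K)" if i: "i < N" for i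
  proof -
    have sub: "(+) (s v i) ` {..<m} \<subseteq> {..<n'}"
      using s_range[OF v i] by auto
    have "centered_on (Suc p) m A (\<phi> \<circ> (+) (s v i))"
      using s_copy[OF v i] sub by (intro centered_on_embed[OF cent]) auto
    moreover have "card ((\<phi> \<circ> (+) (s v i)) ` {..<m}) < N"
      using few'[OF sub] by (simp add: image_comp)
    ultimately show ?thesis
      by (rule forces_colorsE[OF cone]) blast
  qed
  then have "\<forall>i. \<exists>u D. i < N \<longrightarrow> u < m \<and> finite D \<and> l \<le> card D \<and>
      (\<forall>c\<in>D. \<exists>K. color_witness (Suc p) m A (\<phi> \<circ> (+) (s v i)) u c K)"
    by blast
  from choice[OF this] obtain u where
    "\<forall>i. \<exists>D. i < N \<longrightarrow> u i < m \<and> finite D \<and> l \<le> card D \<and>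
      (\<forall>c\<in>D. \<exists>K. color_witness (Suc p) m A (\<phi> \<circ> (+) (s v i)) (u i) c K)" ..
  from choice[OF this] obtain D where
    uD: "\<forall>i<N. u i < m \<and> finite (D i) \<and> l \<le> card (D i) \<and>
      (\<forall>c\<in>D i. \<exists>K. color_witness (Suc p) m A (\<phi> \<circ> (+) (s v i)) (u i) c K)" ..
  have u: "u i < m" and D: "finite (D i)" "l \<le> card (D i)"
    and DK: "\<forall>c\<in>D i. \<exists>K. color_witness (Suc p) m A (\<phi> \<circ> (+) (s v i)) (u i) c K"
    if "i < N" for i
    using uD that by simp_all
  define w where "w i = s v i + u i" for i
  have w: "n \<le> w i \<and> w i < n' \<and> (v, w i) \<in> E'" if "i < N" for i
    using s_range[OF v that] s_join[OF v that u[OF that]] u[OF that] by (auto simp: w_def)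
  \<comment> \<open>Each of the \<open>N\<close> cones at \<open>v\<close> supplies one vertex
    \<open>w i\<close>, but fewer than \<open>N\<close> colors are available, so two of these
    vertices share a color.\<close>
  have "card ((\<lambda>i. \<phi> (w i)) ` {..<N}) < card {..<N}"
    using few'[of "w ` {..<N}"] w by (auto simp: image_image)
  then obtain i j where ij: "i < N" "j < N" "i \<noteq> j" "\<phi> (w i) = \<phi> (w j)"
    using pigeonhole[of "\<lambda>i. \<phi> (w i)" "{..<N}"] by (auto simp: inj_on_def)
  then have wij: "w i \<noteq> w j"
    using s_disj u by (simp add: w_def)
  have "c \<notin> D i" if c: "c \<in> C" for c
  proof
    assume "c \<in> D i"
    then obtain M where M: "color_witness (Suc p) m A (\<phi> \<circ> (+) (s v i)) (u i) c M"
      using DK[OF ij(1)] by blast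
    obtain x where x: "x < m" "\<phi> (s v i + x) = c"
      using color_witnessD(2,4)[OF M] by (auto simp: subset_iff)
    define z where "z = s v i + x"
    obtain K where "color_witness p n E \<phi> v c K"
      using CK c by blast
    note K = color_witnessD[OF this]
    have z: "n \<le> z" "z < n'" "(v, z) \<in> E'" "\<phi> z = c"
      using s_range[OF v ij(1)] s_join[OF v ij(1) x(1)] x by (auto simp: z_def)
    then have "z \<notin> K"
      using K(2) by auto
    have "arc_grown E' (insert z K)"
      using arc_grown_mono[OF K(1) E'(1)] K(3) z(3) by (rule arc_grown.step)
    moreover have "insert z K \<subseteq> {..<n'}"
      using K(2) z(2) E'(2) by auto
    moreover have "\<phi> ` insert z K = \<phi> ` K"
      using K(4) z(4) by (simp add: insert_absorb)
    then have "\<not> Suc p < card (\<phi> ` insert z K)"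
      using K(5) by simp
    ultimately have "\<exists>y\<in>insert z K. \<forall>y'\<in>insert z K. \<phi> y' = \<phi> y \<longrightarrow> y' = y"
      using cent[unfolded centered_on_def, rule_format, of "insert z K"] by blast
    then obtain y where y: "y \<in> insert z K"
      and unique: "\<And>y'. y' \<in> insert z K \<Longrightarrow> \<phi> y' = \<phi> y \<Longrightarrow> y' = y"
      by blast
    \<comment> \<open>No vertex can be unique: color \<open>c\<close> occurs at \<open>z\<close> and
      in \<open>K\<close>, and every other color is repeated inside \<open>K\<close>.\<close>
    show False
    proof (cases "\<phi> y = c")
      case True
      obtain y' where y': "y' \<in> K" "\<phi> y' = c"
        using K(4) by auto
      then have "y' = y" "z = y"
        using True unique[of y'] unique[of z] z(4) by simp_all
      with y'(1) \<open>z \<notin> K\<close> show False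
        by simp
    next
      case False
      then have "y \<in> K"
        using y z(4) by auto
      then show False
        using K(6)[OF _ False] unique by blast
    qed
  qed
  then have "card (C \<union> D i) = card C + card (D i)"
    using C(1) D(1)[OF ij(1)] by (intro card_Un_disjoint) auto
  then have "k + l \<le> card (C \<union> D i)"
    using C(2) D(2)[OF ij(1)] by simp
  moreover have "\<exists>K. color_witness (Suc p) n' E' \<phi> (w i) c K" if c: "c \<in> C \<union> D i" for c
  proof (cases "c \<in> C")
    case True
    then obtain K where "color_witness p n E \<phi> v c K"
      using CK by blast
    note K = color_witnessD[OF this]
    \<comment> \<open>Adding \<open>w i\<close> alone could create a color that occurs once. Its
      twin \<open>w j\<close> repeats that color, and the pair adds at most one color, which the
      step from \<open>p\<close> to \<open>Suc p\<close> allows.\<close>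
    let ?K = "insert (w j) (insert (w i) K)"
    have "arc_grown E' (insert (w i) K)"
      using arc_grown_mono[OF K(1) E'(1)] K(3) w[OF ij(1)] by (blast intro: arc_grown.step)
    then have "arc_grown E' ?K"
      using K(3) w[OF ij(2)] by (blast intro: arc_grown.step)
    moreover have "?K \<subseteq> {..<n'}"
      using K(2) w ij(1,2) E'(2) by auto
    moreover have "\<phi> ` ?K = insert (\<phi> (w i)) (\<phi> ` K)"
      using ij(4) by auto
    then have "card (\<phi> ` ?K) \<le> Suc (Suc p)"
      using K(5) card_insert_le_m1[of "Suc (Suc p)" "\<phi> ` K" "\<phi> (w i)"] by simp
    moreover have "\<forall>x\<in>?K. \<phi> x \<noteq> c \<longrightarrow> (\<exists>y\<in>?K. y \<noteq> x \<and> \<phi> y = \<phi> x)"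
    proof (intro ballI impI)
      fix x assume x: "x \<in> ?K" "\<phi> x \<noteq> c"
      consider "x = w i" | "x = w j" | "x \<in> K"
        using x(1) by blast
      then show "\<exists>y\<in>?K. y \<noteq> x \<and> \<phi> y = \<phi> x"
      proof cases
        case 1
        then show ?thesis
          using wij ij(4) by auto
      next
        case 2
        then show ?thesis
          using wij ij(4) by auto
      next
        case 3
        then show ?thesis
          using K(6) x(2) by blast
      qed
    qed
    ultimately have "color_witness (Suc p) n' E' \<phi> (w i) c ?K"
      using K(4) unfolding color_witness_def by blast
    then show ?thesis ..
  next
    case False
    then obtain K where "color_witness (Suc p) m A (\<phi> \<circ> (+) (s v i)) (u i) c K"
      using c DK[OF ij(1)] by blast
    then have "color_witness (Suc p) n' E' \<phi> (s v i + u i) c ((+) (s v i) ` K)"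
      using s_copy[OF v ij(1)] s_range[OF v ij(1)] by (intro color_witness_embed) auto
    then show ?thesis
      by (auto simp: w_def)
  qed
  ultimately show "\<exists>v<n'. \<exists>C. finite C \<and> k + l \<le> card C \<and>
      (\<forall>c\<in>C. \<exists>K. color_witness (Suc p) n' E' \<phi> v c K)"
    using w[OF ij(1)] C(1) D(1)[OF ij(1)] by (intro exI[of _ "w i"] conjI exI[of _ "C \<union> D i"]) auto
qed

section \<open>The recursive construction\<close>

text \<open>Double induction: the step for \<open>Suc p\<close> and \<open>Suc t\<close> needs both
  \<open>p\<close> with \<open>Suc t\<close> and \<open>Suc p\<close> with \<open>t\<close>, so the
  outer hypothesis is kept general in \<open>t\<close>.\<close>

lemma exists_forcing_graph:
  "\<exists>n E. has_width t n E \<and> forces_colors TYPE('c) N p ((p + t) choose t) n E"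
proof (induction p arbitrary: t)
  case 0
  then show ?case
    using has_width_single[of t] forces_colors_single[of N 0] by fastforce
next
  case (Suc p)
  show ?case
  proof (induction t)
    case 0
    then show ?case
      using has_width_single[of 0] forces_colors_single[of N "Suc p"] by fastforce
  next
    case (Suc t)
    obtain n E where E: "has_width (Suc t) n E"
      "forces_colors TYPE('c) N p ((p + Suc t) choose Suc t) n E"
      using \<open>\<And>t. \<exists>n E. has_width t n E \<and> _ t n E\<close> by blast
    obtain m A where A: "has_width t m A"
      "forces_colors TYPE('c) N (Suc p) ((Suc p + t) choose t) m A"
      using Suc.IH by blast
    have div: "l div N < n" if "l < n * N" for l
      using that by (simp add: less_mult_imp_div_less)
    \<comment> \<open>The apex of cone \<open>l\<close> is \<open>l div N\<close>, so each of the
      \<open>n\<close> old vertices receives exactly \<open>N\<close> cones; \<open>s v i\<close>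
      below is the first vertex of the \<open>i\<close>-th cone at \<open>v\<close>.\<close>
    obtain E' where E': "has_width (Suc t) (n + n * N * m) E'" "E \<subseteq> E'"
      and copies: "\<forall>l<n * N. (\<forall>x<m. (l div N, n + l * m + x) \<in> E') \<and>
        (\<forall>(x, y)\<in>A. (n + l * m + x, n + l * m + y) \<in> E')"
      using has_width_attach_cones[OF E(1) A(1), of "n * N" "\<lambda>l. l div N"] div by blast
    define s where "s v i = n + (v * N + i) * m" for v i
    have idx: "v * N + i < n * N" "(v * N + i) div N = v" if "v < n" "i < N" for v i
    proof -
      have "v * N + i < Suc v * N"
        using that by simp
      also have "Suc v * N \<le> n * N"
        using that by (intro mult_le_mono1) simp
      finally show "v * N + i < n * N" .
    qed (use that in simp)
    have "forces_colors TYPE('c) N (Suc p) (((p + Suc t) choose Suc t) + ((Suc p + t) choose t))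
      (n + n * N * m) E'"
    proof (rule forces_colors_cones[OF E(2) A(2) E'(2), where s = s])
      fix v i assume vi: "v < n" "i < N"
      have "Suc (v * N + i) * m \<le> n * N * m"
        using idx(1)[OF vi] by (intro mult_le_mono1) simp
      then show "n \<le> s v i \<and> s v i + m \<le> n + n * N * m"
        by (simp add: s_def)
      show "(v, s v i + x) \<in> E'" if "x < m" for x
        using copies idx[OF vi] that by (metis s_def)
      show "(s v i + x, s v i + y) \<in> E'" if "(x, y) \<in> A" for x y
        using copies idx[OF vi] that unfolding s_def by blast
    next
      fix v i j x y :: nat
      assume *: "i \<noteq> j" "x < m" "y < m"
      \<comment> \<open>Division by the block length recovers the cone number, hence distinct cones
        are disjoint.\<close>
      have "((v * N + i) * m + x) div m = v * N + i" "((v * N + j) * m + y) div m = v * N + j"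
        using * by simp_all
      then show "s v i + x \<noteq> s v j + y"
        using *(1) unfolding s_def by (metis add.assoc add_left_cancel)
    qed simp
    \<comment> \<open>Pascal's rule turns the sum into the binomial coefficient for
      \<open>Suc p\<close> and \<open>Suc t\<close>.\<close>
    then show ?case
      using E'(1) by (intro exI conjI) (auto simp: add.commute)
  qed
qed

section \<open>Transfer to centered colorings and conclusion\<close>

text \<open>The subgraph induced by a set grown along arcs is connected, so it is an admissible
  \<open>H\<close> in the definition of a centered coloring.\<close>

lemma centered_coloring_imp_centered_on:
  assumes "has_width t n E" "centered_coloring p \<lparr>pverts = {..<n}, parcs = E\<rparr> \<phi>"
  shows "centered_on p n E \<phi>"
  unfolding centered_on_def
proof (intro allI impI)
  fix K assume K: "arc_grown E K \<and> K \<subseteq> {..<n}"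
  let ?G = "\<lparr>pverts = {..<n}, parcs = E\<rparr>" and ?H = "\<lparr>pverts = K, parcs = E \<inter> K \<times> K\<rparr>"
  have E: "sym E" "\<And>u v. (u, v) \<in> E \<Longrightarrow> u \<noteq> v"
    using assms(1) by (auto simp: has_width_def)
  interpret G: pair_graph ?G
    using assms(1) by (rule has_width_treewidth)
  have "finite K"
    using K finite_subset by blast
  then have H: "pair_graph ?H"
    using E by unfold_locales (auto simp: symmetric_def sym_def)
  have "subgraph (with_proj ?H) (with_proj ?G)"
    using K H G.wf_digraph
    by (auto simp: subgraph_def compatible_def wf_digraph_wp_iff pair_graph_def pair_digraph_def
        pair_fin_digraph_def)
  moreover have "connected (with_proj ?H)"
    using K E(1) by (intro arc_grown_connected) auto
  ultimately have "p < card (\<phi> ` K) \<or> (\<exists>c. \<exists>!v. v \<in> K \<and> \<phi> v = c)"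
    using assms(2) H unfolding centered_coloring_def by fastforce
  then show "p < card (\<phi> ` K) \<or> (\<exists>v\<in>K. \<forall>w\<in>K. \<phi> w = \<phi> v \<longrightarrow> w = v)"
    by blast
qed

theorem theorem5:
  fixes p t :: nat
  shows "\<exists>G :: nat pair_pre_digraph. pair_graph G \<and> treewidth G \<le> int t \<and>
           (p + t) choose t \<le> centered_chromatic_number p G"
proof -
  \<comment> \<open>\<open>N\<close> is taken both as the strict bound on the number of colors and
    as the number of colors forced: fewer than \<open>N\<close> colors would then produce
    \<open>N\<close> colors in use.\<close>
  define N where "N = (p + t) choose t"
  obtain n E where E: "has_width t n E" "forces_colors TYPE(nat) N p N n E"
    using exists_forcing_graph unfolding N_def by blast
  define G where "G = \<lparr>pverts = {..<n}, parcs = E\<rparr>"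
  have G: "pair_graph G" "treewidth G \<le> int t"
    using has_width_treewidth[OF E(1)] by (simp_all add: G_def)
  obtain \<phi> :: "nat \<Rightarrow> nat" where \<phi>: "centered_coloring p G \<phi>"
    "card (\<phi> ` pverts G) = centered_chromatic_number p G"
    using centered_chromatic_number_attained[OF G(1)] by blast
  have "N \<le> card (\<phi> ` {..<n})"
  proof (rule ccontr)
    assume "\<not> N \<le> card (\<phi> ` {..<n})"
    then obtain v C where C: "N \<le> card C" "\<forall>c\<in>C. \<exists>K. color_witness p n E \<phi> v c K"
      using E(2) centered_coloring_imp_centered_on[OF E(1)] \<phi>(1)
      unfolding forces_colors_def G_def by (metis not_le)
    have "C \<subseteq> \<phi> ` {..<n}"
      using C(2) unfolding color_witness_def by blast
    then have "card C \<le> card (\<phi> ` {..<n})"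
      by (intro card_mono) auto
    with C(1) \<open>\<not> N \<le> card (\<phi> ` {..<n})\<close> show False
      by simp
  qed
  then show ?thesis
    using G \<phi>(2) by (auto simp: N_def G_def)
qed

end
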